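(* Let $I \subseteq \mathbb{R}$ be an interval with interior $I^{\circ}$, let $f: I \to \mathbb{R}$ be four times differentiable on $I^{\circ}$, let $a,b \in I^{\circ}$ with $a<b$, and suppose $f^{(iv)} \in L[a,b]$. Let $q\ge 1$. If $|f^{(iv)}|^{q}$ is quasi-convex on $[a,b]$, then $$\left| \frac{f(a)+f(b)}{2} - \frac{1}{b-a}\int_a^b f(x)\,dx - \frac{b-a}{12}\,[f'(b)-f'(a)] \right| \le \frac{(b-a)^4}{720}\left(\max\{|f^{(iv)}(a)|^q,|f^{(iv)}(b)|^q\}\right)^{\frac1q}.$$
   Context: A function $g:[a,b]\to\mathbb{R}$ is called quasi-convex on $[a,b]$ if $g(\lambda x+(1-\lambda)y)\le \max\{g(x),g(y)\}$ for all $x,y\in[a,b]$ and all $\lambda\in[0,1]$. $f^{(iv)}$ denotes the fourth derivative of $f$, and $L[a,b]$ denotes the Lebesgue integrable functions on $[a,b]$. *)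

theory Defs
  imports "HOL-Analysis.Analysis"
begin

definition quasi_convex_on :: "real set \<Rightarrow> (real \<Rightarrow> real) \<Rightarrow> bool" where
  "quasi_convex_on S g \<longleftrightarrow>
    (\<forall>x\<in>S. \<forall>y\<in>S. \<forall>t\<in>{0..1}. g (t * x + (1 - t) * y) \<le> max (g x) (g y))"

text \<open>
  The \<open>k\<close>-th derivative is the iterate \<open>(deriv ^^ k) f\<close>. Since \<^const>\<open>deriv\<close> is unspecified where no
  derivative exists, each of the iterates \<open>0, \<dots>, n - 1\<close> is required to be differentiable. The set
  \<open>S\<close> is meant to be open, so that these two-sided derivatives only depend on \<open>f\<close> on \<open>S\<close>.
\<close>
definition times_differentiable_on :: "nat \<Rightarrow> (real \<Rightarrow> real) \<Rightarrow> real set \<Rightarrow> bool" where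
  "times_differentiable_on n f S \<longleftrightarrow>
    (\<forall>k<n. \<forall>x\<in>S. (deriv ^^ k) f differentiable (at x))"

end

theory Submission
  imports Defs
begin

text \<open>
  Let \<open>w x = (x - a)\<^sup>2 (b - x)\<^sup>2 / 24\<close>. Then
  \<open>G = w f''' - w' f'' + w'' f' - w''' f + w'''' (\<integral>\<^sub>a\<^sup>x f)\<close> satisfies \<open>G' = w f''''\<close>, and
  \<open>G b - G a\<close> is \<open>-(b - a)\<close> times the quadrature error. Quasi-convexity bounds \<open>\<bar>f''''\<bar>\<close> by a
  constant \<open>M\<close>, so the mean value inequality compares \<open>G\<close> with \<open>M\<close> times an antiderivative of \<open>w\<close>,
  whose increment over \<open>[a, b]\<close> is \<open>(b - a)\<^sup>5 / 720\<close>. Arguing with \<open>G\<close> instead of \<open>\<integral> w f''''\<close>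
  avoids integrating the possibly discontinuous \<open>f''''\<close>.
\<close>

lemma quasi_convex_on_le_max_endpoints:
  assumes "quasi_convex_on {a..b} g" and "x \<in> {a..b}"
  shows "g x \<le> max (g a) (g b)"
proof -
  have "x \<in> closed_segment a b"
    using assms(2) by (auto simp: closed_segment_eq_real_ivl)
  then obtain u where u: "0 \<le> u" "u \<le> 1" "x = (1 - u) * a + u * b"
    by (auto simp: in_segment)
  have "g ((1 - u) * a + (1 - (1 - u)) * b) \<le> max (g a) (g b)"
    using assms u(1,2) by (intro assms(1)[unfolded quasi_convex_on_def, rule_format]) auto
  then show ?thesis
    using u(3) by simp
qed

text \<open>For \<open>q > 0\<close> the \<open>q\<close>-th root is monotone on nonnegative reals
  and undoes \<open>powr q\<close>, also at \<open>0\<close> since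
  \<open>0 powr q = 0\<close>.\<close>

lemma quasi_convex_on_abs_powr_bound:
  assumes "quasi_convex_on {a..b} (\<lambda>x. \<bar>g x\<bar> powr q)" and "x \<in> {a..b}" and "q > 0"
  shows "\<bar>g x\<bar> \<le> (max (\<bar>g a\<bar> powr q) (\<bar>g b\<bar> powr q)) powr (1 / q)"
proof -
  have "\<bar>g x\<bar> = (\<bar>g x\<bar> powr q) powr (1 / q)"
    using assms(3) by (simp add: powr_powr)
  also have "\<dots> \<le> (max (\<bar>g a\<bar> powr q) (\<bar>g b\<bar> powr q)) powr (1 / q)"
    using quasi_convex_on_le_max_endpoints[OF assms(1,2)] assms(3)
    by (intro powr_mono2) auto
  finally show ?thesis .
qed

lemma times_differentiable_on_DERIV:
  assumes "times_differentiable_on n f S" and "k < n" and "x \<in> S"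
  shows "((deriv ^^ k) f has_real_derivative (deriv ^^ Suc k) f x) (at x)"
  using assms by (simp add: times_differentiable_on_def DERIV_deriv_iff_real_differentiable)

lemma corrected_trapezoid_bound:
  fixes f :: "real \<Rightarrow> real"
  assumes "a < b"
    and f: "\<And>x. x \<in> {a..b} \<Longrightarrow> (f has_real_derivative f1 x) (at x within {a..b})"
    and f1: "\<And>x. x \<in> {a..b} \<Longrightarrow> (f1 has_real_derivative f2 x) (at x within {a..b})"
    and f2: "\<And>x. x \<in> {a..b} \<Longrightarrow> (f2 has_real_derivative f3 x) (at x within {a..b})"
    and f3: "\<And>x. x \<in> {a..b} \<Longrightarrow> (f3 has_real_derivative f4 x) (at x within {a..b})"
    and f4: "\<And>x. x \<in> {a..b} \<Longrightarrow> \<bar>f4 x\<bar> \<le> M"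
  shows "\<bar>(f a + f b) / 2 - 1 / (b - a) * integral {a..b} f - (b - a) / 12 * (f1 b - f1 a)\<bar>
         \<le> (b - a) ^ 4 / 720 * M"
proof -
  define h where "h = b - a"
  have "h > 0"
    using assms(1) by (simp add: h_def)
  define F where "F x = integral {a..x} f" for x
  have F: "(F has_real_derivative f x) (at x within {a..b})" if "x \<in> {a..b}" for x
    unfolding F_def using DERIV_continuous_on[OF f] that by (rule integral_has_real_derivative)
  define w where "w x = (x - a)\<^sup>2 * (b - x)\<^sup>2 / 24" for x
  \<comment> \<open>The antiderivative of \<open>w\<close> that vanishes at \<open>a\<close>, found
    by substituting \<open>b - x = h - (x - a)\<close> and expanding \<open>w\<close> in powers of
    \<open>x - a\<close>.\<close>
  define W where "W x = ((x - a) ^ 5 / 5 - h * (x - a) ^ 4 / 2 + h\<^sup>2 * (x - a) ^ 3 / 3) / 24" for x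
  \<comment> \<open>The coefficients are \<open>w\<close>, \<open>w'\<close>, \<open>w''\<close>,
    \<open>w'''\<close> expanded in the same way; that of \<open>F\<close> is
    \<open>w'''' = 1\<close>.\<close>
  define G where
    "G x = ((x - a) ^ 4 - 2 * h * (x - a) ^ 3 + h\<^sup>2 * (x - a)\<^sup>2) / 24 * f3 x
         - (4 * (x - a) ^ 3 - 6 * h * (x - a)\<^sup>2 + 2 * h\<^sup>2 * (x - a)) / 24 * f2 x
         + (12 * (x - a)\<^sup>2 - 12 * h * (x - a) + 2 * h\<^sup>2) / 24 * f1 x
         - (24 * (x - a) - 12 * h) / 24 * f x + F x" for x
  have w: "w x = ((x - a) ^ 4 - 2 * h * (x - a) ^ 3 + h\<^sup>2 * (x - a)\<^sup>2) / 24" for x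
    by (simp add: w_def h_def field_simps eval_nat_numeral)
  have W: "(W has_real_derivative w x) (at x within {a..b})" for x
    unfolding W_def w
    by (auto intro!: derivative_eq_intros simp: field_simps)
  \<comment> \<open>By the product rule with alternating signs the sum telescopes: only
    \<open>w x * f4 x\<close> survives, \<open>F' = f\<close> cancelling the last term.\<close>
  have G: "(G has_real_derivative w x * f4 x) (at x within {a..b})" if "x \<in> {a..b}" for x
    unfolding G_def w
    by (auto intro!: derivative_eq_intros F[OF that] f[OF that] f1[OF that] f2[OF that] f3[OF that]
        simp: field_simps power2_eq_square power3_eq_cube)
  have "norm (G b - G a) \<le> M * W b - M * W a"
  proof (rule differentiable_bound_general[where f' = "\<lambda>x. w x * f4 x" and \<phi>' = "\<lambda>x. M * w x"])
    show "continuous_on {a..b} G" "continuous_on {a..b} (\<lambda>x. M * W x)"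
      using DERIV_continuous_on[OF G] DERIV_continuous_on[OF W] by (auto intro!: continuous_intros)
    fix x assume x: "a < x" "x < b"
    then have at: "at x within {a..b} = at x"
      by (simp add: at_within_Icc_at)
    show "(G has_vector_derivative w x * f4 x) (at x)"
      using G[of x] x by (simp add: at has_real_derivative_iff_has_vector_derivative)
    show "((\<lambda>x. M * W x) has_vector_derivative M * w x) (at x)"
      using DERIV_cmult[OF W[of x], of M] by (simp add: at has_real_derivative_iff_has_vector_derivative)
    \<comment> \<open>Being a product of squares, \<open>w\<close> is nonnegative, so the bound on
      \<open>f4\<close> can be multiplied by it.\<close>
    have "w x * \<bar>f4 x\<bar> \<le> w x * M"
      using f4[of x] x by (intro mult_left_mono) (auto simp: w_def)
    then show "norm (w x * f4 x) \<le> M * w x"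
      by (simp add: abs_mult w_def mult.commute)
  qed (fact assms(1))
  \<comment> \<open>Here \<open>W a = 0\<close> and \<open>W b = h^5 (1/5 - 1/2 + 1/3) / 24\<close>,
    where the bracket is \<open>1/30\<close>.\<close>
  also have "M * W b - M * W a = h * (h ^ 4 / 720 * M)"
    by (simp add: W_def h_def[symmetric] field_simps eval_nat_numeral)
  \<comment> \<open>The double zeros of \<open>w\<close> at \<open>a\<close> and \<open>b\<close>
    remove \<open>f3\<close> and \<open>f2\<close>. At both ends \<open>w'' = h^2 / 12\<close>,
    while \<open>w'''\<close> is \<open>-h/2\<close> at \<open>a\<close> and \<open>h/2\<close> at
    \<open>b\<close>.\<close>
  also have "G b - G a = - (h * ((f a + f b) / 2 - 1 / h * integral {a..b} f - h / 12 * (f1 b - f1 a)))"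
    using \<open>h > 0\<close>
    by (simp add: G_def F_def h_def[symmetric] field_simps eval_nat_numeral)
  finally show ?thesis
    using \<open>h > 0\<close> by (simp add: abs_mult h_def)
qed

theorem theorem2p4:
  fixes I :: "real set" and f :: "real \<Rightarrow> real" and a b q :: real
  assumes "is_interval I"
    and "times_differentiable_on 4 f (interior I)"
    and "a \<in> interior I" and "b \<in> interior I" and "a < b"
    and "(deriv ^^ 4) f absolutely_integrable_on {a..b}"
    and "q \<ge> 1"
    and "quasi_convex_on {a..b} (\<lambda>x. \<bar>(deriv ^^ 4) f x\<bar> powr q)"
  shows "\<bar>(f a + f b) / 2 - 1 / (b - a) * integral {a..b} f
            - (b - a) / 12 * (deriv f b - deriv f a)\<bar>
         \<le> (b - a) ^ 4 / 720 *
            (max (\<bar>(deriv ^^ 4) f a\<bar> powr q) (\<bar>(deriv ^^ 4) f b\<bar> powr q)) powr (1 / q)"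
proof (rule corrected_trapezoid_bound)
  fix x assume x: "x \<in> {a..b}"
  \<comment> \<open>The interior of a convex set is convex, so it contains all of
    \<open>{a..b}\<close> along with \<open>a\<close> and \<open>b\<close>.\<close>
  have "is_interval (interior I)"
    using assms(1) by (simp add: is_interval_convex_1 convex_interior)
  with assms(3,4) x have "x \<in> interior I"
    unfolding is_interval_1 atLeastAtMost_iff by blast
  then have D: "((deriv ^^ k) f has_real_derivative (deriv ^^ Suc k) f x) (at x within {a..b})"
    if "k < 4" for k
    using times_differentiable_on_DERIV[OF assms(2) that] has_field_derivative_at_within by blast
  show "(f has_real_derivative deriv f x) (at x within {a..b})"
    using D[of 0] by simp
  show "(deriv f has_real_derivative (deriv ^^ 2) f x) (at x within {a..b})"
    using D[of 1] by (simp add: numeral_2_eq_2)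
  show "((deriv ^^ 2) f has_real_derivative (deriv ^^ 3) f x) (at x within {a..b})"
    using D[of 2] by (simp add: eval_nat_numeral)
  show "((deriv ^^ 3) f has_real_derivative (deriv ^^ 4) f x) (at x within {a..b})"
    using D[of 3] by (simp add: eval_nat_numeral)
  show "\<bar>(deriv ^^ 4) f x\<bar>
        \<le> (max (\<bar>(deriv ^^ 4) f a\<bar> powr q) (\<bar>(deriv ^^ 4) f b\<bar> powr q)) powr (1 / q)"
    using quasi_convex_on_abs_powr_bound[OF assms(8) x] assms(7) by simp
qed (fact assms(5))

end
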